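(* Let $G=\{a_1a_2,\,a_1b_2,\,b_1a_2,\,b_1b_2\}$ and let $\mathbb{K}=(G,M,I)$ be the hierarchical nominal formal context with two levels and two categories per level. Then the generalised Tukey depth $T$ is not strongly free with respect to quasiconcavity and with respect to the family $\mathscr{P}$ of all probability measures on $G$.
   Context: A formal context is a triple $\mathbb{K}=(G,M,I)$ with object set $G$, attribute set $M$ and a binary relation $I\subseteq G\times M$. For $A\subseteq G$ put $\Psi(A)=\{m\in M\mid \forall g\in A:(g,m)\in I\}$, and for $B\subseteq M$ put $\Phi(B)=\{g\in G\mid\forall m\in B:(g,m)\in I\}$ (so $\Psi(\emptyset)=M$, $\Phi(\emptyset)=G$). Then $\gamma=\Phi\circ\Psi$ is a closure operator on $2^G$. Hierarchical nominal context: $G=\{a_1a_2,a_1b_2,b_1a_2,b_1b_2\}$, $M=\{a_1,\,b_1,\,a_1a_2,\,a_1b_2,\,b_1a_2,\,b_1b_2\}$. The object $x_1y_2$ (with $x,y\in\{a,b\}$) has exactly the two attributes $x_1$ and $x_1y_2$. Thus $\Psi(\{a_1a_2\})=\{a_1,a_1a_2\}$, $\Psi(\{a_1b_2\})=\{a_1,a_1b_2\}$, $\Psi(\{b_1a_2\})=\{b_1,b_1a_2\}$, $\Psi(\{b_1b_2\})=\{b_1,b_1b_2\}$. A depth function on $\mathbb{K}$ (with respect to $\mathscr{P}$, the set of all probability measures on the power set of $G$) is a function assigning to each $g\in G$ and $\Pr\in\mathscr{P}$ a value $D(g,\mathbb{K},\Pr)\in\mathbb{R}_{\ge0}$. It is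 quasiconcave if for all $\Pr\in\mathscr{P}$, all $A\subseteq G$ and all $g\in\gamma(A)\setminus A$: $D(g,\mathbb{K},\Pr)\ge\inf_{\tilde g\in A}D(\tilde g,\mathbb{K},\Pr)$. The generalised Tukey depth is $T(g,\mathbb{K},\Pr)=1-\sup_{m\in M\setminus\Psi(\{g\})}\Pr(\Phi(\{m\}))$, with the convention that a supremum over the empty index set equals $0$. Strongly free: $D$ is strongly free with respect to $\mathscr{P}$ and quasiconcavity if $D$ is quasiconcave and for every $\varepsilon>0$ there exists a class $\mathscr{P}^\varepsilon\subseteq\mathscr{P}$ with diameter $d(\mathscr{P}^\varepsilon)\le\varepsilon$ such that for every quasiconcave depth function $E$ on $\mathbb{K}$ and every $\Pr\in\mathscr{P}$ there exist $\tilde{\Pr}\in\mathscr{P}^\varepsilon$ and an isotone (i.e. order preserving, nondecreasing) function $f:\mathbb{R}\to\mathbb{R}$ with $f\circ D(\cdot,\mathbb{K},\tilde{\Pr})=E(\cdot,\mathbb{K},\Pr)$. Here the diameter of a set $\mathscr{Q}$ of probability measures is $d(\mathscr{Q})=\sup_{P,Q\in\mathscr{Q}}\sup_{A\subseteq G}|P(A)-Q(A)|$. *)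

theory Defs
  imports "HOL-Probability.Probability"
begin

record ('g, 'm) formal_context =
  objects :: "'g set"
  attributes :: "'m set"
  incidence :: "('g \<times> 'm) set"

definition is_formal_context :: "('g, 'm) formal_context \<Rightarrow> bool" where
  "is_formal_context K \<longleftrightarrow> incidence K \<subseteq> objects K \<times> attributes K"

definition intent :: "('g, 'm) formal_context \<Rightarrow> 'g set \<Rightarrow> 'm set" where
  "intent K A = {m \<in> attributes K. \<forall>g\<in>A. (g, m) \<in> incidence K}"

definition extent :: "('g, 'm) formal_context \<Rightarrow> 'm set \<Rightarrow> 'g set" where
  "extent K B = {g \<in> objects K. \<forall>m\<in>B. (g, m) \<in> incidence K}"

definition context_closure :: "('g, 'm) formal_context \<Rightarrow> 'g set \<Rightarrow> 'g set" where
  "context_closure K = extent K \<circ> intent K"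

definition all_prob_measures :: "'g set \<Rightarrow> 'g measure set" where
  "all_prob_measures G = {P. prob_space P \<and> space P = G \<and> sets P = Pow G}"

text \<open>
  The context \<open>K\<close> is fixed, so a depth function on \<open>K\<close> is a curried function of the object and
  the probability measure. Only its values on \<open>objects K\<close> and on the family \<open>\<P>\<close> are relevant.
\<close>

definition depth_function ::
    "('g, 'm) formal_context \<Rightarrow> 'g measure set \<Rightarrow> ('g \<Rightarrow> 'g measure \<Rightarrow> real) \<Rightarrow> bool" where
  "depth_function K \<P> D \<longleftrightarrow> (\<forall>g\<in>objects K. \<forall>P\<in>\<P>. 0 \<le> D g P)"

text \<open>
  The infimum is taken in the extended reals, so that it is \<open>\<infinity>\<close> for \<open>A = {}\<close>. This case is
  void whenever no object has all attributes, since then the closure of \<open>{}\<close> is empty.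
\<close>

definition quasiconcave ::
    "('g, 'm) formal_context \<Rightarrow> 'g measure set \<Rightarrow> ('g \<Rightarrow> 'g measure \<Rightarrow> real) \<Rightarrow> bool" where
  "quasiconcave K \<P> D \<longleftrightarrow>
    (\<forall>P\<in>\<P>. \<forall>A\<subseteq>objects K. \<forall>g \<in> context_closure K A - A.
      ereal (D g P) \<ge> (INF g'\<in>A. ereal (D g' P)))"

text \<open>The supremum over the empty set of reals is unspecified, hence the case distinction.\<close>

definition tukey_depth :: "('g, 'm) formal_context \<Rightarrow> 'g \<Rightarrow> 'g measure \<Rightarrow> real" where
  "tukey_depth K g P =
    1 - (if attributes K - intent K {g} = {} then 0
         else (SUP m \<in> attributes K - intent K {g}. measure P (extent K {m})))"

definition family_diameter :: "'g set \<Rightarrow> 'g measure set \<Rightarrow> ennreal" where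
  "family_diameter G \<Q> =
    (SUP P\<in>\<Q>. SUP Q\<in>\<Q>. SUP A\<in>Pow G. ennreal \<bar>measure P A - measure Q A\<bar>)"

definition strongly_free_quasiconcave ::
    "('g, 'm) formal_context \<Rightarrow> 'g measure set \<Rightarrow> ('g \<Rightarrow> 'g measure \<Rightarrow> real) \<Rightarrow> bool" where
  "strongly_free_quasiconcave K \<P> D \<longleftrightarrow>
    depth_function K \<P> D \<and> quasiconcave K \<P> D \<and>
    (\<forall>\<epsilon>::real. \<epsilon> > 0 \<longrightarrow>
      (\<exists>\<Q>\<subseteq>\<P>. family_diameter (objects K) \<Q> \<le> ennreal \<epsilon> \<and>
        (\<forall>E. depth_function K \<P> E \<and> quasiconcave K \<P> E \<longrightarrow>
          (\<forall>P\<in>\<P>. \<exists>P'\<in>\<Q>. \<exists>f :: real \<Rightarrow> real.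
            mono f \<and> (\<forall>g\<in>objects K. f (D g P') = E g P)))))"

datatype category = Cat_a | Cat_b

text \<open>\<open>Object x y\<close> is the object \<open>x\<^sub>1y\<^sub>2\<close>; \<open>Level1 x\<close> and \<open>Level2 x y\<close> are the attributes
  \<open>x\<^sub>1\<close> and \<open>x\<^sub>1y\<^sub>2\<close>.\<close>

datatype hn_object = Object category category

datatype hn_attribute = Level1 category | Level2 category category

definition hierarchical_nominal_context :: "(hn_object, hn_attribute) formal_context" where
  "hierarchical_nominal_context =
    \<lparr>objects = {Object Cat_a Cat_a, Object Cat_a Cat_b, Object Cat_b Cat_a, Object Cat_b Cat_b},
     attributes = {Level1 Cat_a, Level1 Cat_b, Level2 Cat_a Cat_a, Level2 Cat_a Cat_b,
                   Level2 Cat_b Cat_a, Level2 Cat_b Cat_b},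
     incidence = {(Object x y, m) | x y m. m = Level1 x \<or> m = Level2 x y}\<rparr>"

lemma is_formal_context_hierarchical_nominal_context:
  "is_formal_context hierarchical_nominal_context"
  unfolding is_formal_context_def
proof (rule subrelI)
  fix g m
  assume "(g, m) \<in> incidence hierarchical_nominal_context"
  then obtain x y where "g = Object x y" "m = Level1 x \<or> m = Level2 x y"
    by (auto simp: hierarchical_nominal_context_def)
  then show "(g, m) \<in> objects hierarchical_nominal_context \<times> attributes hierarchical_nominal_context"
    by (cases x; cases y) (auto simp: hierarchical_nominal_context_def)
qed

lemma intent_hierarchical_nominal_context:
  "intent hierarchical_nominal_context {Object x y} = {Level1 x, Level2 x y}"
  by (cases x; cases y) (auto simp: intent_def hierarchical_nominal_context_def)

end

theory Submission
  imports Defs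
begin

text \<open>
  Strong freeness requires that one small class \<open>\<Q>\<close> of measures lets \<open>T\<close> reproduce all
  quasiconcave depth functions, in particular the indicator of the extent of each attribute.
  Reproducing the indicator of the object \<open>x\<^sub>1y\<^sub>2\<close> means that some \<open>P \<in> \<Q>\<close> makes this object
  strictly deeper than all others (\<open>strongly_free_separates_extents\<close>). The sibling of
  \<open>x\<^sub>1y\<^sub>2\<close> below the same first-level category \<open>x\<close> lacks the same attributes, except that the two
  second-level attributes of \<open>x\<close> are exchanged. The sibling can therefore be strictly less deep
  only if the attribute \<open>x\<^sub>1y\<^sub>2\<close> dominates everything else that counts, in particular the opposite
  first-level category: the single object \<open>x\<^sub>1y\<^sub>2\<close> must outweigh that whole category
  (\<open>tukey_sibling_order_imp_mass_dominates\<close>).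

  Let \<open>\<alpha>\<close> and \<open>\<beta>\<close> be the masses of the first-level categories \<open>a\<close> and \<open>b\<close>. If
  all measures of \<open>\<Q>\<close> almost agree, then for any one of them, up to small errors, both objects of
  \<open>a\<close> have mass at least \<open>\<beta>\<close>, so \<open>\<alpha> \<ge> 2\<beta>\<close>; and an object of \<open>b\<close> has mass at least \<open>\<alpha>\<close>,
  so \<open>\<beta> \<ge> \<alpha>\<close>. Hence \<open>\<alpha>\<close> and \<open>\<beta>\<close> are both close to 0, against \<open>\<alpha> + \<beta> = 1\<close>.
\<close>

section \<open>Indicators of extents as quasiconcave depth functions\<close>

lemma extent_attribute_superset_closure:
  assumes "m \<in> attributes K" and "A \<subseteq> extent K {m}"
  shows "context_closure K A \<subseteq> extent K {m}"
  using assms by (auto simp: context_closure_def extent_def intent_def)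

text \<open>
  A point of the closure outside the extent forces a point of \<open>A\<close> outside the extent. The
  assumption on \<open>K\<close> makes the closure of the empty set empty; otherwise its points would need
  infinite depth.
\<close>
lemma quasiconcave_extent_indicator:
  assumes m: "m \<in> attributes K" and no_full: "extent K (attributes K) = {}"
  shows "quasiconcave K \<P> (\<lambda>g P. indicator (extent K {m}) g)"
  unfolding quasiconcave_def
proof (intro ballI allI impI)
  fix A g
  assume A: "A \<subseteq> objects K" and g: "g \<in> context_closure K A - A"
  show "(INF h\<in>A. ereal (indicator (extent K {m}) h)) \<le> ereal (indicator (extent K {m}) g)"
  proof (cases "g \<in> extent K {m}")
    case True
    have "A \<noteq> {}"
      using g no_full by (auto simp: context_closure_def intent_def)
    then obtain h where "h \<in> A" by blast
    then show ?thesis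
      using True by (intro INF_lower2[of h]) (auto simp: indicator_def)
  next
    case False
    then obtain h where "h \<in> A" "h \<notin> extent K {m}"
      using extent_attribute_superset_closure[OF m, of A] g by blast
    then show ?thesis
      using False by (intro INF_lower2[of h]) auto
  qed
qed

lemma measure_diff_le_family_diameter:
  assumes "family_diameter G \<Q> \<le> ennreal e" and "0 \<le> e"
    and "P \<in> \<Q>" "Q \<in> \<Q>" "A \<subseteq> G"
  shows "\<bar>measure P A - measure Q A\<bar> \<le> e"
proof -
  have "ennreal \<bar>measure P A - measure Q A\<bar> \<le> family_diameter G \<Q>"
    unfolding family_diameter_def using assms(3-5)
    by (intro SUP_upper2[of P] SUP_upper2[of Q] SUP_upper2[of A]) auto
  also note assms(1)
  finally have "ennreal \<bar>measure P A - measure Q A\<bar> \<le> ennreal e" .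
  with assms(2) show ?thesis by simp
qed

text \<open>
  An isotone function that turns the values of \<open>D\<close> into the indicator of an extent cannot send a
  larger value to 0 and a smaller or equal one to 1.
\<close>
lemma strongly_free_separates_extents:
  assumes free: "strongly_free_quasiconcave K \<P> D" and "\<P> \<noteq> {}"
    and no_full: "extent K (attributes K) = {}" and "0 < e"
  obtains \<Q> where "\<Q> \<subseteq> \<P>"
    and "\<And>P Q A. \<lbrakk>P \<in> \<Q>; Q \<in> \<Q>; A \<subseteq> objects K\<rbrakk> \<Longrightarrow> \<bar>measure P A - measure Q A\<bar> \<le> e"
    and "\<And>m. m \<in> attributes K \<Longrightarrow>
           \<exists>P\<in>\<Q>. \<forall>g\<in>extent K {m}. \<forall>h\<in>objects K - extent K {m}. D h P < D g P"
proof -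
  obtain P\<^sub>0 where P\<^sub>0: "P\<^sub>0 \<in> \<P>" using \<open>\<P> \<noteq> {}\<close> by blast
  from free have "\<exists>\<Q>\<subseteq>\<P>. family_diameter (objects K) \<Q> \<le> ennreal e \<and>
      (\<forall>E. depth_function K \<P> E \<and> quasiconcave K \<P> E \<longrightarrow>
        (\<forall>P\<in>\<P>. \<exists>P'\<in>\<Q>. \<exists>f::real \<Rightarrow> real. mono f \<and> (\<forall>g\<in>objects K. f (D g P') = E g P)))"
    using \<open>0 < e\<close> by (simp add: strongly_free_quasiconcave_def)
  then obtain \<Q> where \<Q>: "\<Q> \<subseteq> \<P>" "family_diameter (objects K) \<Q> \<le> ennreal e"
    and E: "\<forall>E. depth_function K \<P> E \<and> quasiconcave K \<P> E \<longrightarrow>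
        (\<forall>P\<in>\<P>. \<exists>P'\<in>\<Q>. \<exists>f::real \<Rightarrow> real. mono f \<and> (\<forall>g\<in>objects K. f (D g P') = E g P))"
    by (elim exE conjE)
  show thesis
  proof (rule that[OF \<Q>(1)])
    fix P Q A assume "P \<in> \<Q>" "Q \<in> \<Q>" "A \<subseteq> objects K"
    then show "\<bar>measure P A - measure Q A\<bar> \<le> e"
      using measure_diff_le_family_diameter[OF \<Q>(2)] \<open>0 < e\<close> by simp
  next
    fix m assume m: "m \<in> attributes K"
    let ?E = "\<lambda>g P. indicator (extent K {m}) g :: real"
    have "depth_function K \<P> ?E" by (simp add: depth_function_def)
    from E[rule_format, OF conjI[OF this quasiconcave_extent_indicator[OF m no_full]] P\<^sub>0]
    obtain P f where P: "P \<in> \<Q>" and f: "mono (f :: real \<Rightarrow> real)"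
      and fE: "\<And>g. g \<in> objects K \<Longrightarrow> f (D g P) = indicator (extent K {m}) g" by auto
    have "D h P < D g P" if "g \<in> extent K {m}" "h \<in> objects K - extent K {m}" for g h
    proof (rule ccontr)
      assume "\<not> D h P < D g P"
      then have "f (D g P) \<le> f (D h P)" using f by (simp add: monoD)
      moreover have "g \<in> objects K" using that(1) by (simp add: extent_def)
      ultimately show False using that by (simp add: fE)
    qed
    with P show "\<exists>P\<in>\<Q>. \<forall>g\<in>extent K {m}. \<forall>h\<in>objects K - extent K {m}. D h P < D g P"
      by blast
  qed
qed

section \<open>Tukey depth in the hierarchical nominal context\<close>

abbreviation "\<H> \<equiv> hierarchical_nominal_context"

lemma objects_hierarchical_nominal_context [simp]: "objects \<H> = UNIV"
proof -
  have "Object x y \<in> objects \<H>" for x y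
    by (cases x; cases y) (simp_all add: hierarchical_nominal_context_def)
  then have "g \<in> objects \<H>" for g
    by (cases g) simp
  then show ?thesis by blast
qed

lemma attributes_hierarchical_nominal_context [simp]: "attributes \<H> = UNIV"
proof -
  have "Level1 x \<in> attributes \<H>" "Level2 x y \<in> attributes \<H>" for x y
    by (cases x; cases y; simp add: hierarchical_nominal_context_def)+
  then have "m \<in> attributes \<H>" for m
    by (cases m) simp_all
  then show ?thesis by blast
qed

lemma incidence_hierarchical_nominal_context [simp]:
  "(Object x y, m) \<in> incidence \<H> \<longleftrightarrow> m = Level1 x \<or> m = Level2 x y"
  by (auto simp: hierarchical_nominal_context_def)

lemma extent_Level1: "extent \<H> {Level1 x} = range (Object x)"
proof -
  have "g \<in> extent \<H> {Level1 x} \<longleftrightarrow> g \<in> range (Object x)" for g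
    by (cases g) (auto simp: extent_def)
  then show ?thesis by blast
qed

lemma extent_Level2: "extent \<H> {Level2 x y} = {Object x y}"
proof -
  have "g \<in> extent \<H> {Level2 x y} \<longleftrightarrow> g \<in> {Object x y}" for g
    by (cases g) (auto simp: extent_def)
  then show ?thesis by blast
qed

lemma extent_all_attributes: "extent \<H> UNIV = {}"
proof -
  have "Object x y \<notin> extent \<H> UNIV" for x y
  proof -
    obtain x' where "x' \<noteq> x" by (cases x) auto
    then have "(Object x y, Level1 x') \<notin> incidence \<H>" by simp
    then show ?thesis unfolding extent_def by blast
  qed
  then have "g \<notin> extent \<H> UNIV" for g
    by (cases g) simp
  then show ?thesis by blast
qed

lemma UNIV_category: "UNIV = {Cat_a, Cat_b}"
  using category.exhaust by auto

lemma finite_attributes: "finite (A :: hn_attribute set)"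
proof (rule finite_subset)
  show "A \<subseteq> attributes \<H>" by simp
  show "finite (attributes \<H>)" unfolding hierarchical_nominal_context_def by simp
qed

text \<open>
  Let the supremum that defines the depth of the sibling \<open>Object x y'\<close> be attained at \<open>m\<close>. Every
  attribute missing from the sibling, except \<open>Level2 x y\<close>, is missing from \<open>Object x y\<close> as well, so
  it cannot make the sibling strictly less deep; hence \<open>m = Level2 x y\<close>. Its mass exceeds the
  supremum for \<open>Object x y\<close>, to which the opposite category \<open>x'\<close> contributes.
\<close>
lemma tukey_sibling_order_imp_mass_dominates:
  assumes P: "prob_space P" "sets P = UNIV" and "x \<noteq> x'"
    and less: "tukey_depth \<H> (Object x y') P < tukey_depth \<H> (Object x y) P"
  shows "measure P (range (Object x')) < measure P {Object x y}"
proof -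
  interpret prob_space P by fact
  let ?\<mu> = "\<lambda>m. measure P (extent \<H> {m})"
  let ?M = "\<lambda>z. - {Level1 x, Level2 x z}"
  have opposite: "Level1 x' \<in> ?M z" for z
    using \<open>x \<noteq> x'\<close> by simp
  then have nonempty: "?M z \<noteq> {}" for z
    by (metis empty_iff)
  have T: "tukey_depth \<H> (Object x z) P = 1 - (SUP m\<in>?M z. ?\<mu> m)" for z
    using nonempty by (simp add: tukey_depth_def intent_hierarchical_nominal_context Compl_eq_Diff_UNIV)
  have opposite_le: "?\<mu> (Level1 x') \<le> (SUP m\<in>?M y. ?\<mu> m)"
    by (rule cSUP_upper[OF opposite]) (simp add: finite_attributes)
  have "(SUP m\<in>?M y. ?\<mu> m) < (SUP m\<in>?M y'. ?\<mu> m)"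
    using less by (simp add: T)
  then obtain m where m: "m \<in> ?M y'"
      and gt_y: "(SUP m\<in>?M y. ?\<mu> m) < ?\<mu> m"
    using less_cSUP_iff[OF nonempty, of ?\<mu>] finite_attributes by fastforce
  with opposite_le have gt: "?\<mu> (Level1 x') < ?\<mu> m" by linarith
  have "m \<notin> ?M y"
  proof
    assume "m \<in> ?M y"
    then have "?\<mu> m \<le> (SUP m\<in>?M y. ?\<mu> m)"
      by (rule cSUP_upper) (simp add: finite_attributes)
    with gt_y show False by simp
  qed
  with m have "m = Level2 x y" by auto
  with gt show ?thesis by (simp add: extent_Level1 extent_Level2)
qed

theorem theorem10:
  "\<not> strongly_free_quasiconcave hierarchical_nominal_context
       (all_prob_measures (objects hierarchical_nominal_context))
       (tukey_depth hierarchical_nominal_context)"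
proof
  let ?\<P> = "all_prob_measures (objects \<H>)"
  assume free: "strongly_free_quasiconcave \<H> ?\<P> (tukey_depth \<H>)"
  have "?\<P> \<noteq> {}"
  proof -
    have "return (count_space UNIV) g \<in> ?\<P>" for g
      by (simp add: all_prob_measures_def prob_space_return)
    then show ?thesis by blast
  qed
  \<comment> \<open>For diameter \<open>\<epsilon>\<close>, each first-level category would have mass less than \<open>4\<epsilon>\<close>, so \<open>\<epsilon> = 1/8\<close> is small enough.\<close>
  then obtain \<Q> where \<Q>: "\<Q> \<subseteq> ?\<P>"
    and close: "\<And>P Q A. \<lbrakk>P \<in> \<Q>; Q \<in> \<Q>\<rbrakk> \<Longrightarrow> \<bar>measure P A - measure Q A\<bar> \<le> 1/8"
    and sep: "\<And>m. \<exists>P\<in>\<Q>. \<forall>g\<in>extent \<H> {m}. \<forall>h\<in>- extent \<H> {m}.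
                tukey_depth \<H> h P < tukey_depth \<H> g P"
    using strongly_free_separates_extents[OF free, of "1/8"] extent_all_attributes
    by (auto simp: Compl_eq_Diff_UNIV)
  have prob: "prob_space P" "sets P = UNIV" "space P = UNIV" if "P \<in> \<Q>" for P
    using \<Q> that by (auto simp: all_prob_measures_def)
  have dominates: "\<exists>P\<in>\<Q>. measure P (range (Object x')) < measure P {Object x y}"
    if "x \<noteq> x'" for x x' y
  proof -
    obtain y' where "y' \<noteq> y" by (cases y) auto
    with sep[of "Level2 x y"] obtain P where "P \<in> \<Q>"
      and "tukey_depth \<H> (Object x y') P < tukey_depth \<H> (Object x y) P"
      by (auto simp: extent_Level2)
    with tukey_sibling_order_imp_mass_dominates[OF prob(1,2)] that show ?thesis by blast
  qed

  let ?a = "range (Object Cat_a)" and ?b = "range (Object Cat_b)"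
  let ?aa = "{Object Cat_a Cat_a}" and ?ab = "{Object Cat_a Cat_b}" and ?ba = "{Object Cat_b Cat_a}"
  obtain P Q R where \<Q>': "P \<in> \<Q>" "Q \<in> \<Q>" "R \<in> \<Q>"
    and P: "measure P ?b < measure P ?aa"
    and Q: "measure Q ?b < measure Q ?ab"
    and R: "measure R ?a < measure R ?ba"
    using dominates[of Cat_a Cat_b] dominates[of Cat_b Cat_a] by (metis category.distinct(1))
  interpret R: prob_space R using prob(1) \<Q>'(3) .
  note R_sets = prob(2,3)[OF \<Q>'(3)]
  have "measure R ?a = measure R ?aa + measure R ?ab"
    using R.finite_measure_Union[of ?aa ?ab] by (simp add: UNIV_category R_sets insert_commute)
  moreover have "measure R ?ba \<le> measure R ?b"
    by (rule R.finite_measure_mono) (auto simp: R_sets)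
  moreover have "measure R ?a + measure R ?b = 1"
  proof -
    have "g \<in> ?a \<union> ?b" for g
      using UNIV_category by (cases g) auto
    then have "?a \<union> ?b = space R" by (auto simp: R_sets)
    then show ?thesis
      using R.finite_measure_Union[of ?a ?b] R.prob_space by (auto simp: R_sets)
  qed
  ultimately show False
    using P Q R close[OF \<Q>'(1,3), of ?aa] close[OF \<Q>'(1,3), of ?b]
      close[OF \<Q>'(2,3), of ?ab] close[OF \<Q>'(2,3), of ?b]
    by linarith
qed

end
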